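(* Let $p>1$ be a real number and let $d>0$. Then the best possible constants $\lambda_1$ and $\eta_1$ such that the double inequality $$e^{\lambda_1x^p}<\cosh_p x<e^{\eta_1x^p}$$ holds for all $x\in(0,d)$ are $\lambda_1=\dfrac{\ln(\cosh_p d)}{d^p}$ and $\eta_1=\dfrac1p$ respectively. Here "best possible" means that the inequalities hold for all $x\in(0,d)$ with these constants, and that $\lambda_1$ cannot be replaced by any larger constant, nor $\eta_1$ by any smaller constant, so that the respective inequality still holds for all $x\in(0,d)$.
   Context: For real $1<p<\infty$, define $\operatorname{arcsinh}_p:\mathbb{R}\to\mathbb{R}$ by $\operatorname{arcsinh}_p x=\int_0^x\frac{dt}{(1+t^p)^{1/p}}$ for $x\ge0$ and $\operatorname{arcsinh}_p x=-\operatorname{arcsinh}_p(-x)$ for $x<0$. The generalized hyperbolic sine function $\sinh_p$ is the inverse of $\operatorname{arcsinh}_p$. The generalized hyperbolic cosine function is $\cosh_p x=\frac{d}{dx}\sinh_p x$ (for $x\geq 0$, $\cosh_p x=(1+\sinh_p^p x)^{1/p}$, where $\sinh_p^p x=(\sinh_p x)^p$). *)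

theory Defs
  imports "HOL-Analysis.Analysis"
begin

definition arcsinh_p :: "real \<Rightarrow> real \<Rightarrow> real" where
  "arcsinh_p p x =
    (if x \<ge> 0 then integral {0..x} (\<lambda>t. 1 / (1 + t powr p) powr (1 / p))
     else - integral {0..-x} (\<lambda>t. 1 / (1 + t powr p) powr (1 / p)))"

text \<open>For \<open>p > 1\<close> the map \<open>arcsinh_p p\<close> is a bijection of the real line (the integrand is
  positive and asymptotic to \<open>1 / t\<close> at infinity), so \<open>inv\<close> is its two-sided inverse.\<close>

definition sinh_p :: "real \<Rightarrow> real \<Rightarrow> real" where
  "sinh_p p = inv (arcsinh_p p)"

definition cosh_p :: "real \<Rightarrow> real \<Rightarrow> real" where
  "cosh_p p x = deriv (sinh_p p) x"

end

theory Submission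
  imports Defs
begin

text \<open>
  The whole theorem is one fact about the exponent \<open>ln (cosh_p p x) / x powr p\<close>: on the positive
  half-line it is continuous and strictly decreasing, and it tends to \<open>1 / p\<close> at \<open>0\<close>. Hence on
  \<open>(0, d)\<close> it lies strictly between its value at \<open>d\<close> and \<open>1 / p\<close>, and since these
  are its limits at the two ends of the interval, neither bound can be improved.

  Everything is computed in the coordinate \<open>s = sinh_p p x\<close>, so \<open>x = arcsinh_p p s\<close>. The derivative of
  \<open>x\<close> is then \<open>1 / C\<close> with \<open>C = (1 + s powr p) powr (1 / p)\<close>, and the rule for the derivative of an
  inverse function gives \<open>cosh_p p x = C\<close> (\<open>cosh_p_arcsinh_p\<close>). What remains
  concerns elementary functions of \<open>s\<close> and the integral \<open>arcsinh_p\<close>.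

  Monotonicity comes from two applications of the monotone form of l'Hospital's rule: a quotient of
  functions vanishing at \<open>0\<close> decreases if the quotient of their derivatives does. For
  \<open>ln C / x powr p\<close> the quotient of the derivatives is \<open>(T / x) powr (p - 1) / p\<close>, where
  \<open>T = s / C\<close> is the generalized hyperbolic tangent (\<open>cosh_exponent_bounds\<close>). For \<open>T / x\<close> it is
  \<open>1 / (1 + s powr p)\<close>, which visibly decreases (\<open>tanh_over_arcsinh\<close>). The same two steps give
  the bounds \<open>(1 + s powr p) powr (1 - p) / p < ln C / x powr p < 1 / p\<close>, and
  thereby the limit at \<open>0\<close>.
\<close>

section \<open>Quotients of functions with a decreasing quotient of derivatives\<close>

text \<open>
  By Cauchy's mean value theorem the quotient \<open>f x / g x\<close> is a value of \<open>f' / g'\<close> to the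
  left of \<open>x\<close>, hence exceeds \<open>f' x / g' x\<close>. That inequality says precisely that the numerator
  \<open>f' g - f g'\<close> in the derivative of \<open>f / g\<close> is negative.
\<close>

lemma
  fixes f g f' g' :: "real \<Rightarrow> real"
  assumes contf: "continuous_on {0..} f" and contg: "continuous_on {0..} g"
    and zero: "f 0 = 0" "g 0 = 0"
    and derf: "\<And>x. x > 0 \<Longrightarrow> (f has_real_derivative f' x) (at x)"
    and derg: "\<And>x. x > 0 \<Longrightarrow> (g has_real_derivative g' x) (at x)"
    and g'_pos: "\<And>x. x > 0 \<Longrightarrow> g' x > 0"
    and decr: "\<And>x y. 0 < x \<Longrightarrow> x < y \<Longrightarrow> f' y / g' y < f' x / g' x"
  shows monotone_lhopital_mean: "\<And>x. x > 0 \<Longrightarrow> \<exists>\<xi>\<in>{0<..<x}. f x / g x = f' \<xi> / g' \<xi>"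
    and monotone_lhopital_lower: "\<And>x. x > 0 \<Longrightarrow> f' x / g' x < f x / g x"
    and monotone_lhopital_decreasing: "\<And>x y. 0 < x \<Longrightarrow> x < y \<Longrightarrow> f y / g y < f x / g x"
proof -
  have g_pos: "g x > 0" if "x > 0" for x
  proof -
    have "g 0 < g x"
    proof (rule DERIV_pos_imp_increasing_open[OF that])
      show "continuous_on {0..x} g"
        by (rule continuous_on_subset[OF contg]) auto
    qed (use derg g'_pos in blast)
    then show ?thesis using zero by simp
  qed
  show mean: "\<exists>\<xi>\<in>{0<..<x}. f x / g x = f' \<xi> / g' \<xi>" if x: "x > 0" for x
  proof -
    \<comment> \<open>Cauchy's mean value theorem in its usual reduction to Rolle's: \<open>h\<close> vanishes at \<open>0\<close> and \<open>x\<close>.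
      Continuity at \<open>0\<close> is available from the right only.\<close>
    define h where "h z = f z * g x - g z * f x" for z
    have derh: "(h has_real_derivative f' z * g x - g' z * f x) (at z)" if "z > 0" for z
    proof -
      note [derivative_intros] = derf[OF that] derg[OF that]
      show ?thesis unfolding h_def by (auto intro!: derivative_eq_intros)
    qed
    have conth: "continuous_on {0..x} h"
      unfolding h_def
      by (intro continuous_intros continuous_on_subset[OF contf] continuous_on_subset[OF contg]) auto
    have "\<exists>l z. 0 < z \<and> z < x \<and> (h has_real_derivative l) (at z) \<and> h x - h 0 = (x - 0) * l"
      by (rule MVT[OF x conth]) (use derh real_differentiable_def in blast)
    then obtain l z where z: "0 < z" "z < x" "(h has_real_derivative l) (at z)"
        and eq: "h x - h 0 = (x - 0) * l" by blast
    have "l = 0" using eq x zero by (simp add: h_def)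
    then have "f' z * g x - g' z * f x = 0"
      using z derh DERIV_unique by blast
    then show ?thesis using z g_pos[OF x] g'_pos[of z]
      by (intro bexI[of _ z]) (auto simp: field_simps)
  qed
  show lower: "f' x / g' x < f x / g x" if x: "x > 0" for x
    using mean[OF x] decr by force
  show "f y / g y < f x / g x" if x: "0 < x" and xy: "x < y" for x y
  proof (rule DERIV_neg_imp_decreasing[OF xy])
    fix z assume "x \<le> z" "z \<le> y"
    then have z: "z > 0" using x by simp
    have "((\<lambda>u. f u / g u) has_real_derivative (f' z * g z - f z * g' z) / (g z * g z)) (at z)"
      using g_pos[OF z] by (intro DERIV_divide derf derg z) auto
    moreover have "f' z * g z - f z * g' z < 0"
      using lower[OF z] g_pos[OF z] g'_pos[OF z] by (simp add: field_simps)
    then have "(f' z * g z - f z * g' z) / (g z * g z) < 0"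
      using g_pos[OF z] by (simp add: divide_less_0_iff)
    ultimately show "\<exists>D. ((\<lambda>u. f u / g u) has_real_derivative D) (at z) \<and> D < 0" by blast
  qed
qed

section \<open>The generalized inverse hyperbolic sine\<close>

text \<open>
  The hyperbolic cosine as a function of the hyperbolic sine, by the generalized Pythagorean relation
  \<open>cosh_p p x powr p = 1 + sinh_p p x powr p\<close>. Its reciprocal is the integrand of \<open>arcsinh_p\<close>.
\<close>

definition cosh_of_sinh :: "real \<Rightarrow> real \<Rightarrow> real" where
  "cosh_of_sinh p s = (1 + s powr p) powr (1 / p)"

lemma one_plus_powr_pos: "1 + (s :: real) powr p > 0"
  by (simp add: add_pos_nonneg)

lemma cosh_of_sinh_pos: "cosh_of_sinh p s > 0"
  using one_plus_powr_pos[of s p] by (simp add: cosh_of_sinh_def)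

lemma one_plus_powr_neq_0 [simp]: "1 + (s :: real) powr p \<noteq> 0"
  and cosh_of_sinh_neq_0 [simp]: "cosh_of_sinh p s \<noteq> 0"
  using one_plus_powr_pos[of s p] cosh_of_sinh_pos[of p s] by linarith+

lemma cosh_of_sinh_powr:
  "p \<noteq> 0 \<Longrightarrow> cosh_of_sinh p s powr p = 1 + s powr p"
  using one_plus_powr_pos[of s p] by (simp add: cosh_of_sinh_def powr_powr)

lemma ln_cosh_of_sinh: "ln (cosh_of_sinh p s) = ln (1 + s powr p) / p"
  using one_plus_powr_pos[of s p] by (simp add: cosh_of_sinh_def ln_powr)

lemma continuous_on_cosh_of_sinh:
  "p > 0 \<Longrightarrow> continuous_on {0..} (cosh_of_sinh p)"
  unfolding cosh_of_sinh_def
  by (intro continuous_intros continuous_on_powr') auto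

text \<open>
  This serves only to compare the integrand of \<open>arcsinh_p\<close> with \<open>1 / (1 + t)\<close>, so as to see that
  \<open>arcsinh_p\<close> is unbounded. One power of \<open>1 + s\<close> is split off, and the remaining factor
  \<open>(1 + s) powr (p - 1)\<close> is at least \<open>1\<close> and at least \<open>s powr (p - 1)\<close>.
\<close>

lemma one_plus_powr_le:
  fixes s p :: real
  assumes "p \<ge> 1" "s \<ge> 0"
  shows "1 + s powr p \<le> (1 + s) powr p"
proof -
  have "s powr p = s * s powr (p - 1)"
    using assms by (cases "s = 0") (auto simp: powr_diff)
  also have "\<dots> \<le> s * (1 + s) powr (p - 1)"
    using assms by (intro mult_left_mono powr_mono2) auto
  finally have "1 + s powr p \<le> (1 + s) powr (p - 1) + s * (1 + s) powr (p - 1)"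
    using assms ge_one_powr_ge_zero[of "1 + s" "p - 1"] by simp
  also have "\<dots> = (1 + s) powr p"
    using assms powr_add[of "1 + s" 1 "p - 1"] by (simp add: algebra_simps)
  finally show ?thesis .
qed

lemma cosh_of_sinh_le: "p \<ge> 1 \<Longrightarrow> s \<ge> 0 \<Longrightarrow> cosh_of_sinh p s \<le> 1 + s"
  using powr_mono2[of "1 / p" "1 + s powr p" "(1 + s) powr p"] one_plus_powr_le[of p s]
    one_plus_powr_pos[of s p]
  by (simp add: cosh_of_sinh_def powr_powr)

lemma arcsinh_p_nonneg_eq:
  "s \<ge> 0 \<Longrightarrow> arcsinh_p p s = integral {0..s} (\<lambda>t. 1 / cosh_of_sinh p t)"
  by (simp add: arcsinh_p_def cosh_of_sinh_def)

lemma arcsinh_p_neg: "s < 0 \<Longrightarrow> arcsinh_p p s = - arcsinh_p p (- s)"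
  by (simp add: arcsinh_p_def)

lemma arcsinh_p_0: "arcsinh_p p 0 = 0"
  by (simp add: arcsinh_p_def)

definition tanh_of_sinh :: "real \<Rightarrow> real \<Rightarrow> real" where
  "tanh_of_sinh p s = s / cosh_of_sinh p s"

text \<open>
  The number \<open>c\<close> with \<open>cosh_p p x = exp (c * x powr p)\<close>, as a function of \<open>s = sinh_p p x\<close>.
\<close>

definition cosh_exponent :: "real \<Rightarrow> real \<Rightarrow> real" where
  "cosh_exponent p s = ln (cosh_of_sinh p s) / arcsinh_p p s powr p"

context
  fixes p :: real
  assumes p: "p > 1"
begin

lemma arcsinh_p_has_derivative_within:
  assumes "0 \<le> s" "s \<le> b"
  shows "(arcsinh_p p has_real_derivative 1 / cosh_of_sinh p s) (at s within {0..b})"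
proof -
  have "continuous_on {0..b} (cosh_of_sinh p)"
    using p by (intro continuous_on_subset[OF continuous_on_cosh_of_sinh]) auto
  then have "continuous_on {0..b} (\<lambda>t. 1 / cosh_of_sinh p t)"
    by (intro continuous_intros) auto
  then have "((\<lambda>x. integral {0..x} (\<lambda>t. 1 / cosh_of_sinh p t))
      has_real_derivative 1 / cosh_of_sinh p s) (at s within {0..b})"
    using assms by (intro integral_has_real_derivative) auto
  then show ?thesis
    by (rule has_field_derivative_transform_within[where d = 1])
      (use assms in \<open>auto simp: arcsinh_p_nonneg_eq\<close>)
qed

lemma arcsinh_p_has_derivative:
  assumes "s > 0"
  shows "(arcsinh_p p has_real_derivative 1 / cosh_of_sinh p s) (at s)"
  using arcsinh_p_has_derivative_within[of s "s + 1"] at_within_Icc_at[of 0 s "s + 1"] assms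
  by simp

lemma continuous_on_arcsinh_p: "continuous_on {0..} (arcsinh_p p)"
  unfolding continuous_on_eq_continuous_within
proof
  fix s :: real assume "s \<in> {0..}"
  then have s: "s \<ge> 0" by simp
  have "continuous (at s within {0..s + 1}) (arcsinh_p p)"
    using arcsinh_p_has_derivative_within[of s "s + 1"] s by (auto intro: DERIV_continuous)
  moreover have "at s within {0..} = at s within {0..s + 1}"
    by (rule at_within_nhd[of _ "{..<s + 1}"]) auto
  ultimately show "continuous (at s within {0..}) (arcsinh_p p)" by simp
qed

lemma arcsinh_p_strict_mono:
  assumes "0 \<le> s" "s < t"
  shows "arcsinh_p p s < arcsinh_p p t"
proof (rule DERIV_pos_imp_increasing_open[OF assms(2)])
  show "continuous_on {s..t} (arcsinh_p p)"
    by (rule continuous_on_subset[OF continuous_on_arcsinh_p]) (use assms in auto)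
next
  fix x assume "s < x"
  then have "x > 0" using assms by simp
  then show "\<exists>y. (arcsinh_p p has_real_derivative y) (at x) \<and> y > 0"
    using arcsinh_p_has_derivative cosh_of_sinh_pos by (meson zero_less_divide_1_iff)
qed

lemma arcsinh_p_pos: "s > 0 \<Longrightarrow> arcsinh_p p s > 0"
  using arcsinh_p_strict_mono[of 0 s] by (simp add: arcsinh_p_0)

lemma arcsinh_p_ge_ln:
  assumes "s \<ge> 0"
  shows "ln (1 + s) \<le> arcsinh_p p s"
proof -
  have "arcsinh_p p 0 - ln (1 + 0) \<le> arcsinh_p p s - ln (1 + s)"
  proof (rule DERIV_nonneg_imp_increasing_open[OF assms])
    fix x assume x: "0 < x" "x < s"
    have "((\<lambda>x. arcsinh_p p x - ln (1 + x)) has_real_derivative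
        1 / cosh_of_sinh p x - 1 / (1 + x)) (at x)"
      using x by (auto intro!: derivative_eq_intros arcsinh_p_has_derivative)
    moreover have "1 / (1 + x) \<le> 1 / cosh_of_sinh p x"
      using x p cosh_of_sinh_le[of p x] cosh_of_sinh_pos[of p x] by (intro divide_left_mono) auto
    ultimately show "\<exists>y. ((\<lambda>x. arcsinh_p p x - ln (1 + x)) has_real_derivative y) (at x) \<and> 0 \<le> y"
      by (metis diff_ge_0_iff_ge)
  next
    show "continuous_on {0..s} (\<lambda>x. arcsinh_p p x - ln (1 + x))"
      by (intro continuous_intros continuous_on_subset[OF continuous_on_arcsinh_p]) auto
  qed
  then show ?thesis by (simp add: arcsinh_p_0)
qed

lemma arcsinh_p_surj_pos:
  assumes "x > 0"
  obtains s where "s > 0" "arcsinh_p p s = x"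
proof -
  have "\<exists>s\<ge>0. s \<le> exp x \<and> arcsinh_p p s = x"
  proof (rule IVT')
    have "x = ln (exp x)" by simp
    also have "\<dots> \<le> ln (1 + exp x)" by (subst ln_le_cancel_iff) (auto intro: add_pos_pos)
    also have "\<dots> \<le> arcsinh_p p (exp x)" by (rule arcsinh_p_ge_ln) simp
    finally show "x \<le> arcsinh_p p (exp x)" .
    show "continuous_on {0..exp x} (arcsinh_p p)"
      by (rule continuous_on_subset[OF continuous_on_arcsinh_p]) auto
  qed (use assms in \<open>auto simp: arcsinh_p_0\<close>)
  then obtain s where "s \<ge> 0" "arcsinh_p p s = x" by blast
  moreover from this have "s \<noteq> 0" using assms by (auto simp: arcsinh_p_0)
  ultimately show ?thesis by (intro that[of s]) auto
qed

text \<open>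
  As \<open>sinh_p\<close> chooses a preimage from the whole real line, even a positive argument calls for
  injectivity there, which follows from the monotonicity on \<open>{0..}\<close> and oddness.
\<close>

lemma sinh_p_arcsinh_p:
  assumes "s > 0"
  shows "sinh_p p (arcsinh_p p s) = s"
proof -
  have "inj (arcsinh_p p)"
  proof (rule linorder_injI)
    fix x y :: real assume xy: "x < y"
    consider "0 \<le> x" | "x < 0" "0 \<le> y" | "y < 0" by linarith
    then have "arcsinh_p p x < arcsinh_p p y"
    proof cases
      case 1
      then show ?thesis using arcsinh_p_strict_mono xy by blast
    next
      case 2
      then have "arcsinh_p p x < 0" "0 \<le> arcsinh_p p y"
        using arcsinh_p_pos[of "- x"] arcsinh_p_pos[of y]
        by (cases "y = 0"; simp add: arcsinh_p_neg arcsinh_p_0)+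
      then show ?thesis by simp
    next
      case 3
      then show ?thesis
        using arcsinh_p_strict_mono[of "- y" "- x"] xy by (simp add: arcsinh_p_neg)
    qed
    then show "arcsinh_p p x \<noteq> arcsinh_p p y" by simp
  qed
  then show ?thesis by (simp add: sinh_p_def)
qed

lemma isCont_sinh_p:
  assumes "x > 0"
  shows "isCont (sinh_p p) x"
proof -
  obtain s where s: "s > 0" "arcsinh_p p s = x" using arcsinh_p_surj_pos[OF assms] .
  have "isCont (sinh_p p) (arcsinh_p p s)"
  proof (rule isCont_inverse_function[where f = "arcsinh_p p" and x = s and d = "s / 2"])
    show "s / 2 > 0" using s by simp
    fix z assume "\<bar>z - s\<bar> \<le> s / 2"
    then have "z > 0" using s by (auto simp: abs_if split: if_splits)
    then show "sinh_p p (arcsinh_p p z) = z" "isCont (arcsinh_p p) z"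
      using sinh_p_arcsinh_p arcsinh_p_has_derivative DERIV_isCont by blast+
  qed
  then show ?thesis using s by simp
qed

text \<open>
  The bridge from the definition of \<open>cosh_p\<close> as a derivative to an explicit function of
  \<open>s = sinh_p p x\<close>: the derivative of an inverse is the reciprocal of the derivative.
\<close>

lemma cosh_p_arcsinh_p:
  assumes "s > 0"
  shows "cosh_p p (arcsinh_p p s) = cosh_of_sinh p s"
proof -
  define x where "x = arcsinh_p p s"
  have x: "x > 0" using arcsinh_p_pos assms by (simp add: x_def)
  have "(sinh_p p has_real_derivative inverse (1 / cosh_of_sinh p s)) (at x)"
  proof (rule DERIV_inverse_function)
    show "(arcsinh_p p has_real_derivative 1 / cosh_of_sinh p s) (at (sinh_p p x))"
      using assms by (simp add: x_def sinh_p_arcsinh_p arcsinh_p_has_derivative)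
    show "1 / cosh_of_sinh p s \<noteq> 0" using cosh_of_sinh_pos[of p s] by simp
    show "0 < x" "x < x + 1" using x by auto
    show "arcsinh_p p (sinh_p p y) = y" if "0 < y" for y
      using arcsinh_p_surj_pos[OF that] sinh_p_arcsinh_p by metis
  qed (rule isCont_sinh_p[OF x])
  then show ?thesis by (simp add: cosh_p_def x_def DERIV_imp_deriv)
qed

section \<open>Monotonicity of the exponent\<close>

lemma continuous_on_tanh_of_sinh: "continuous_on {0..} (tanh_of_sinh p)"
  unfolding tanh_of_sinh_def
  using p by (intro continuous_intros continuous_on_cosh_of_sinh) auto

lemma tanh_of_sinh_has_derivative:
  assumes s: "s > 0"
  shows "(tanh_of_sinh p has_real_derivative 1 / (cosh_of_sinh p s * (1 + s powr p))) (at s)"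
proof -
  \<comment> \<open>Both terms of the product rule carry the factor \<open>q powr (- 1 / p) / q\<close>; its coefficients
    \<open>q\<close> and \<open>- (s powr p)\<close> add up to \<open>1\<close>.\<close>
  define q where "q = 1 + s powr p"
  have q: "q > 0" unfolding q_def by (rule one_plus_powr_pos)
  have eq: "tanh_of_sinh p = (\<lambda>s. s * (1 + s powr p) powr (- (1 / p)))"
    by (simp add: fun_eq_iff tanh_of_sinh_def cosh_of_sinh_def powr_minus_divide)
  have "(tanh_of_sinh p has_real_derivative
      q powr (- (1 / p)) - s * s powr (p - 1) * q powr (- (1 / p) - 1)) (at s)"
    unfolding eq using s p q
    by (auto intro!: derivative_eq_intros simp: q_def[symmetric])
  moreover have "q powr (- (1 / p)) - s * s powr (p - 1) * q powr (- (1 / p) - 1)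
      = (q - s powr p) * q powr (- (1 / p)) / q"
    using s q by (simp add: powr_diff field_simps)
  moreover have "\<dots> = 1 / (cosh_of_sinh p s * q)"
    by (simp add: q_def cosh_of_sinh_def powr_minus_divide)
  ultimately show ?thesis by (simp add: q_def)
qed

text \<open>
  The derivatives of numerator and denominator have the quotient \<open>1 / (1 + s powr p)\<close>, which is
  decreasing and below \<open>1\<close>, so the monotone l'Hospital rule gives all three claims.
\<close>

lemma tanh_over_arcsinh:
  assumes s: "s > 0"
  shows tanh_over_arcsinh_less: "tanh_of_sinh p s / arcsinh_p p s < 1"
    and tanh_over_arcsinh_greater: "1 / (1 + s powr p) < tanh_of_sinh p s / arcsinh_p p s"
    and tanh_over_arcsinh_decreasing:
      "s < t \<Longrightarrow> tanh_of_sinh p t / arcsinh_p p t < tanh_of_sinh p s / arcsinh_p p s"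
proof -
  let ?f' = "\<lambda>s. 1 / (cosh_of_sinh p s * (1 + s powr p))" and ?g' = "\<lambda>s. 1 / cosh_of_sinh p s"
  have quot: "?f' s / ?g' s = 1 / (1 + s powr p)" for s
    using cosh_of_sinh_pos[of p s] by simp
  have decr: "?f' y / ?g' y < ?f' x / ?g' x" if "0 < x" "x < y" for x y
    unfolding quot using that p one_plus_powr_pos[of _ p] powr_less_mono2[of p x y]
    by (intro divide_strict_left_mono) auto
  have T0: "tanh_of_sinh p 0 = 0" by (simp add: tanh_of_sinh_def)
  have pos: "?g' x > 0" for x using cosh_of_sinh_pos[of p x] by simp
  note lh = continuous_on_tanh_of_sinh continuous_on_arcsinh_p T0 arcsinh_p_0
    tanh_of_sinh_has_derivative arcsinh_p_has_derivative pos decr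
  show "tanh_of_sinh p s / arcsinh_p p s < 1"
    using monotone_lhopital_mean[OF lh s] unfolding quot by (auto simp: one_plus_powr_pos)
  show "1 / (1 + s powr p) < tanh_of_sinh p s / arcsinh_p p s"
    using monotone_lhopital_lower[OF lh s] unfolding quot .
  show "tanh_of_sinh p t / arcsinh_p p t < tanh_of_sinh p s / arcsinh_p p s" if "s < t"
    using monotone_lhopital_decreasing[OF lh s that] .
qed

text \<open>
  The derivatives of numerator and denominator have the quotient \<open>R s powr (p - 1) / p\<close> with
  \<open>R s = tanh_of_sinh p s / arcsinh_p p s\<close>; as \<open>p > 1\<close>, it inherits from \<open>R\<close> that it decreases. Its
  bounds in turn come from \<open>1 / (1 + s powr p) < R s < 1\<close>.
  The explicit lower bound is there because it tends to the upper one as \<open>s\<close> tends to \<open>0\<close>.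
\<close>

lemma cosh_exponent_bounds:
  assumes s: "s > 0"
  shows cosh_exponent_less: "cosh_exponent p s < 1 / p"
    and cosh_exponent_greater: "1 / p * (1 / (1 + s powr p)) powr (p - 1) < cosh_exponent p s"
    and cosh_exponent_decreasing: "s < t \<Longrightarrow> cosh_exponent p t < cosh_exponent p s"
proof -
  let ?R = "\<lambda>s. tanh_of_sinh p s / arcsinh_p p s"
  let ?f = "\<lambda>s. ln (cosh_of_sinh p s)" and ?g = "\<lambda>s. arcsinh_p p s powr p"
  let ?f' = "\<lambda>s. s powr (p - 1) / (1 + s powr p)"
    and ?g' = "\<lambda>s. p * arcsinh_p p s powr (p - 1) / cosh_of_sinh p s"
  have Rpos: "?R s > 0" if "s > 0" for s
    using that arcsinh_p_pos cosh_of_sinh_pos[of p s] by (simp add: tanh_of_sinh_def)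
  have quot: "?f' s / ?g' s = 1 / p * ?R s powr (p - 1)" if s: "s > 0" for s
  proof -
    let ?C = "cosh_of_sinh p s"
    have C: "?C > 0" by (rule cosh_of_sinh_pos)
    have "1 + s powr p = ?C powr (p - 1) * ?C"
      using cosh_of_sinh_powr[of p s] p C by (simp add: powr_diff)
    then show ?thesis
      using s C p arcsinh_p_pos[OF s]
      by (simp add: tanh_of_sinh_def powr_divide powr_mult field_simps)
  qed
  have derf: "(?f has_real_derivative ?f' s) (at s)" if "s > 0" for s
    unfolding ln_cosh_of_sinh using that p one_plus_powr_pos[of s p]
    by (auto intro!: derivative_eq_intros)
  have derg: "(?g has_real_derivative ?g' s) (at s)" if "s > 0" for s
    using that p arcsinh_p_pos[OF that]
    by (auto intro!: derivative_eq_intros arcsinh_p_has_derivative)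
  have g'_pos: "?g' s > 0" if "s > 0" for s
    using that p arcsinh_p_pos[OF that] cosh_of_sinh_pos[of p s] by simp
  have decr: "?f' y / ?g' y < ?f' x / ?g' x" if "0 < x" "x < y" for x y
  proof -
    have "?R y powr (p - 1) < ?R x powr (p - 1)"
      using that p Rpos[of y] tanh_over_arcsinh_decreasing[of x y]
      by (intro powr_less_mono2) auto
    then show ?thesis
      using p unfolding quot[OF that(1)] quot[OF less_trans[OF that]]
      by (intro mult_strict_left_mono) auto
  qed
  have contf: "continuous_on {0..} ?f"
    using p by (intro continuous_intros continuous_on_cosh_of_sinh) auto
  have Anonneg: "arcsinh_p p s \<ge> 0" if "s \<ge> 0" for s
    using that arcsinh_p_pos[of s] by (cases "s = 0") (auto simp: arcsinh_p_0)
  have contg: "continuous_on {0..} ?g"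
    using p Anonneg
    by (intro continuous_on_powr' continuous_on_arcsinh_p continuous_intros) auto
  have zero: "?f 0 = 0" "?g 0 = 0" by (auto simp: cosh_of_sinh_def arcsinh_p_0)
  note lh = contf contg zero derf derg g'_pos decr
  show "cosh_exponent p s < 1 / p"
  proof -
    obtain \<xi> where \<xi>: "0 < \<xi>" and eq: "cosh_exponent p s = ?f' \<xi> / ?g' \<xi>"
      using monotone_lhopital_mean[OF lh s] by (auto simp: cosh_exponent_def)
    have "?R \<xi> powr (p - 1) < 1 powr (p - 1)"
      using p \<xi> Rpos[of \<xi>] tanh_over_arcsinh_less[of \<xi>] by (intro powr_less_mono2) auto
    then show ?thesis unfolding eq quot[OF \<xi>] using p by (simp add: divide_strict_right_mono)
  qed
  show "cosh_exponent p t < cosh_exponent p s" if "s < t"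
    unfolding cosh_exponent_def using monotone_lhopital_decreasing[OF lh s that] .
  have "(1 / (1 + s powr p)) powr (p - 1) < ?R s powr (p - 1)"
    using p s tanh_over_arcsinh_greater[OF s] one_plus_powr_pos[of s p]
    by (intro powr_less_mono2) auto
  then have "1 / p * (1 / (1 + s powr p)) powr (p - 1) < 1 / p * ?R s powr (p - 1)"
    using p by (intro mult_strict_left_mono) auto
  also have "\<dots> < cosh_exponent p s"
    using monotone_lhopital_lower[OF lh s] unfolding quot[OF s] cosh_exponent_def .
  finally show "1 / p * (1 / (1 + s powr p)) powr (p - 1) < cosh_exponent p s" .
qed

lemma cosh_exponent_tendsto: "(cosh_exponent p \<longlongrightarrow> 1 / p) (at_right 0)"
proof (rule tendsto_sandwich)
  have pos: "\<forall>\<^sub>F s in at_right (0 :: real). s > 0"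
    by (simp add: eventually_at_right_less)
  show "\<forall>\<^sub>F s in at_right 0. 1 / p * (1 / (1 + s powr p)) powr (p - 1) \<le> cosh_exponent p s"
    using pos by eventually_elim (use cosh_exponent_greater less_imp_le in blast)
  show "\<forall>\<^sub>F s in at_right 0. cosh_exponent p s \<le> 1 / p"
    using pos by eventually_elim (use cosh_exponent_less less_imp_le in blast)
  have powr_lim: "((\<lambda>s. s powr p) \<longlongrightarrow> 0 powr p) (at_right 0)"
    using p pos by (intro tendsto_powr' tendsto_intros disjI2 conjI) (auto elim: eventually_mono)
  have "((\<lambda>s. 1 / p * (1 / (1 + s powr p)) powr (p - 1))
      \<longlongrightarrow> 1 / p * (1 / (1 + 0 powr p)) powr (p - 1)) (at_right 0)"
    by (intro tendsto_mult tendsto_const tendsto_powr tendsto_divide tendsto_add powr_lim) auto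
  then show "((\<lambda>s. 1 / p * (1 / (1 + s powr p)) powr (p - 1)) \<longlongrightarrow> 1 / p) (at_right 0)"
    by simp
qed simp

lemma cosh_p_eq_exp_cosh_exponent:
  assumes "s > 0"
  shows "cosh_p p (arcsinh_p p s) = exp (cosh_exponent p s * arcsinh_p p s powr p)"
  using assms arcsinh_p_pos[OF assms] cosh_of_sinh_pos[of p s]
  by (simp add: cosh_p_arcsinh_p cosh_exponent_def)

end

theorem theorem3p5:
  fixes p d :: real
  assumes "p > 1" and "d > 0"
  defines "lambda1 \<equiv> ln (cosh_p p d) / d powr p"
    and "eta1 \<equiv> 1 / p"
  shows "(\<forall>x\<in>{0<..<d}. exp (lambda1 * x powr p) < cosh_p p x \<and> cosh_p p x < exp (eta1 * x powr p))
    \<and> (\<forall>l>lambda1. \<not> (\<forall>x\<in>{0<..<d}. exp (l * x powr p) < cosh_p p x))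
    \<and> (\<forall>e<eta1. \<not> (\<forall>x\<in>{0<..<d}. cosh_p p x < exp (e * x powr p)))"
proof -
  note p = \<open>p > 1\<close>
  note A_pos = arcsinh_p_pos[OF p] and A_mono = arcsinh_p_strict_mono[OF p]
  \<comment> \<open>The substitution \<open>x = ?A s\<close> turns \<open>(0, d)\<close> into \<open>(0, D)\<close> and every inequality of the theorem
    into one between a constant and \<open>?E s\<close>.\<close>
  let ?A = "arcsinh_p p" and ?E = "cosh_exponent p"
  obtain D where D: "D > 0" "?A D = d" using arcsinh_p_surj_pos[OF p \<open>d > 0\<close>] .
  have lambda1: "lambda1 = ?E D"
    using cosh_p_arcsinh_p[OF p D(1)] D by (simp add: lambda1_def cosh_exponent_def)
  have in_range: "?A s \<in> {0<..<d}" if "s \<in> {0<..<D}" for s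
    using that D A_pos A_mono[of s D] by auto
  have exp_less_cosh: "exp (c * ?A s powr p) < cosh_p p (?A s) \<longleftrightarrow> c < ?E s"
    and cosh_less_exp: "cosh_p p (?A s) < exp (c * ?A s powr p) \<longleftrightarrow> ?E s < c" if "s > 0" for c s
    using that A_pos[OF that] by (auto simp: cosh_p_eq_exp_cosh_exponent[OF p])
  have bounds: "exp (lambda1 * x powr p) < cosh_p p x \<and> cosh_p p x < exp (eta1 * x powr p)"
    if x: "x \<in> {0<..<d}" for x
  proof -
    obtain s where s: "s > 0" "?A s = x" using arcsinh_p_surj_pos[OF p, of x] x by auto
    have "s < D" using A_mono[of D s] x s D by (cases D s rule: linorder_cases) auto
    then show ?thesis
      using exp_less_cosh[of s lambda1] cosh_less_exp[of s eta1] s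
        cosh_exponent_decreasing[OF p, of s D] cosh_exponent_less[OF p, of s]
      by (simp add: lambda1 eta1_def)
  qed
  have lambda_sharp: "\<not> (\<forall>x\<in>{0<..<d}. exp (l * x powr p) < cosh_p p x)" if l: "l > lambda1" for l
  proof
    assume *: "\<forall>x\<in>{0<..<d}. exp (l * x powr p) < cosh_p p x"
    have "isCont ?A D"
      using arcsinh_p_has_derivative[OF p D(1)] DERIV_isCont by blast
    then have "isCont ?E D"
      unfolding cosh_exponent_def[abs_def] ln_cosh_of_sinh
      using D p \<open>d > 0\<close> one_plus_powr_pos[of D p]
      by (intro continuous_intros) auto
    then have "(?E \<longlongrightarrow> ?E D) (at_left D)"
      by (simp add: isCont_def filterlim_at_split)
    moreover have "\<forall>\<^sub>F s in at_left D. s \<in> {0<..<D}"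
      using D by (intro eventually_at_leftI[of 0]) auto
    then have "\<forall>\<^sub>F s in at_left D. l \<le> ?E s"
    proof eventually_elim
      case (elim s)
      then show ?case using *[rule_format, OF in_range] exp_less_cosh[of s l] by simp
    qed
    ultimately have "l \<le> ?E D"
      by (rule tendsto_lowerbound) simp
    then show False using l lambda1 by simp
  qed
  have eta_sharp: "\<not> (\<forall>x\<in>{0<..<d}. cosh_p p x < exp (e * x powr p))" if e: "e < eta1" for e
  proof
    assume *: "\<forall>x\<in>{0<..<d}. cosh_p p x < exp (e * x powr p)"
    have "\<forall>\<^sub>F s in at_right 0. s \<in> {0<..<D}"
      using D by (intro eventually_at_rightI[of _ D]) auto
    then have "\<forall>\<^sub>F s in at_right 0. ?E s \<le> e"
    proof eventually_elim
      case (elim s)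
      then show ?case using *[rule_format, OF in_range] cosh_less_exp[of s e] by simp
    qed
    then have "1 / p \<le> e"
      by (intro tendsto_upperbound[OF cosh_exponent_tendsto[OF p]]) auto
    then show False using e by (simp add: eta1_def)
  qed
  show ?thesis using bounds lambda_sharp eta_sharp by blast
qed

end
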